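(* Let $\mathcal{A}$ be the adjacency matrix of a graph on $N$ nodes with $\mathcal{A}_{ii}=1$ for all $i$. Consider any plant with state-space dynamics $\dot x=Ax+B_1w+B_2u$, $z=C_1x+D_{12}u$, $y=C_2x+D_{21}w$, where $x,u,y$ are partitioned into $N$ site sub-signals. If a proper rational transfer matrix $K$ (controller $u=Ky$) is closed-loop TF-structured with respect to $\mathcal{A}$ for this plant, then $K$ is $\mathcal{A}$-structured-realizable.
   Context: Closed-loop TF-structure: consider the auxiliary system $\dot x=Ax+B_2u+\delta_x$, $y=C_2x+\delta_y$ in feedback with $u=Ky$ (assumed well-posed), and let $\Phi=\begin{bmatrix}\Phi_{xx}&\Phi_{xy}\\ \Phi_{ux}&\Phi_{uy}\end{bmatrix}$ be the resulting closed-loop transfer matrix from $(\delta_x,\delta_y)$ to $(x,u)$. $K$ is closed-loop TF-structured with respect to $\mathcal{A}$ if each of $\Phi_{xx},\Phi_{xy},\Phi_{ux},\Phi_{uy}$ (with inputs and outputs partitioned by site) is TF-structured with respect to $\mathcal{A}$, meaning its $(i,j)$ block is identically zero whenever $\mathcal{A}_{ij}=0$. A matrix $M$ partitioned into $N\times N$ blocks is in $\mathcal{S}(\mathcal{A})$ if its $(i,j)$ block is zero whenever $\mathcal{A}_{ij}=0$. An LTI system is $\mathcal{A}$-structured-realizable if it has a state-space realization $(A_K,B_K,C_K,D_K)$, with state partitioned into $N$ (possibly empty) sub-states, such that $A_K,B_K,C_K,D_K\in\mathcal{S}(\mathcal{A})$. *)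

theory Defs
  imports "HOL-Computational_Algebra.Polynomial" "HOL-Computational_Algebra.Fraction_Field"
          "Jordan_Normal_Form.Matrix"
begin

text \<open>Transfer functions: real rational functions in the Laplace variable s,
  i.e. elements of the fraction field of real polynomials.\<close>

type_synonym rfun = "real poly fract"

definition s_var :: rfun where "s_var = Fract [:0, 1:] 1"

definition const_rf :: "real \<Rightarrow> rfun" where "const_rf r = Fract [:r:] 1"

definition rmat :: "real mat \<Rightarrow> rfun mat" where "rmat M = map_mat const_rf M"

definition proper_rf :: "rfun \<Rightarrow> bool" where
  "proper_rf f \<longleftrightarrow> (\<exists>p q. q \<noteq> 0 \<and> degree p \<le> degree q \<and> f = Fract p q)"

definition proper_tf :: "rfun mat \<Rightarrow> bool" where
  "proper_tf K \<longleftrightarrow> (\<forall>i<dim_row K. \<forall>j<dim_col K. proper_rf (K $$ (i,j)))"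

definition inv_m :: "'a::field mat \<Rightarrow> 'a mat" where
  "inv_m M = (THE N. N \<in> carrier_mat (dim_row M) (dim_row M) \<and>
                     M * N = 1\<^sub>m (dim_row M) \<and> N * M = 1\<^sub>m (dim_row M))"

definition resolvent :: "real mat \<Rightarrow> rfun mat" where
  "resolvent A = inv_m (s_var \<cdot>\<^sub>m 1\<^sub>m (dim_row A) - rmat A)"

definition sub_mat :: "'a mat \<Rightarrow> nat \<Rightarrow> nat \<Rightarrow> nat \<Rightarrow> nat \<Rightarrow> 'a mat" where
  "sub_mat M r0 nr c0 nc = mat nr nc (\<lambda>(i,j). M $$ (r0 + i, c0 + j))"

text \<open>Structure: a matrix whose rows are assigned to sites by rs and columns by cs
  (site labels in {0..<N}) lies in S(Adj) iff its (i,j) block vanishes whenever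
  Adj_ij = 0.  The same notion is "TF-structured" for transfer matrices.\<close>
definition in_S :: "'b::zero mat \<Rightarrow> 'a::zero mat \<Rightarrow> (nat \<Rightarrow> nat) \<Rightarrow> (nat \<Rightarrow> nat) \<Rightarrow> bool" where
  "in_S Adj M rs cs \<longleftrightarrow>
     (\<forall>a<dim_row M. \<forall>b<dim_col M. Adj $$ (rs a, cs b) = 0 \<longrightarrow> M $$ (a, b) = 0)"

definition site_map :: "nat \<Rightarrow> nat \<Rightarrow> (nat \<Rightarrow> nat) \<Rightarrow> bool" where
  "site_map N d \<sigma> \<longleftrightarrow> (\<forall>a<d. \<sigma> a < N)"

text \<open>Closed loop of  x' = A x + B2 u + dx,  y = C2 x + dy,  u = K y.
  In the Laplace domain:  [sI-A, -B2; -K C2, I] [x; u] = [I, 0; 0, K] [dx; dy].\<close>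
definition loop_mat :: "real mat \<Rightarrow> real mat \<Rightarrow> real mat \<Rightarrow> rfun mat \<Rightarrow> rfun mat" where
  "loop_mat A B2 C2 K =
     four_block_mat (s_var \<cdot>\<^sub>m 1\<^sub>m (dim_row A) - rmat A) (- rmat B2)
                    (- (K * rmat C2)) (1\<^sub>m (dim_col B2))"

definition well_posed :: "real mat \<Rightarrow> real mat \<Rightarrow> real mat \<Rightarrow> rfun mat \<Rightarrow> bool" where
  "well_posed A B2 C2 K \<longleftrightarrow> invertible_mat (loop_mat A B2 C2 K)"

definition closed_loop_map :: "real mat \<Rightarrow> real mat \<Rightarrow> real mat \<Rightarrow> rfun mat \<Rightarrow> rfun mat" where
  "closed_loop_map A B2 C2 K =
     inv_m (loop_mat A B2 C2 K) *
       four_block_mat (1\<^sub>m (dim_row A)) (0\<^sub>m (dim_row A) (dim_row C2))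
                      (0\<^sub>m (dim_col B2) (dim_row A)) K"

text \<open>Phi = [Phi_xx, Phi_xy; Phi_ux, Phi_uy], from (dx,dy) to (x,u).
  n = #states, m = #inputs, p = #measurements; sx, su, sy the site maps.\<close>
definition cl_TF_structured ::
  "real mat \<Rightarrow> real mat \<Rightarrow> real mat \<Rightarrow> real mat \<Rightarrow> (nat \<Rightarrow> nat) \<Rightarrow> (nat \<Rightarrow> nat) \<Rightarrow> (nat \<Rightarrow> nat)
   \<Rightarrow> rfun mat \<Rightarrow> bool" where
  "cl_TF_structured Adj A B2 C2 sx su sy K \<longleftrightarrow>
     (let n = dim_row A; m = dim_col B2; p = dim_row C2;
          Phi = closed_loop_map A B2 C2 K
      in in_S Adj (sub_mat Phi 0 n 0 n) sx sx \<and>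
         in_S Adj (sub_mat Phi 0 n n p) sx sy \<and>
         in_S Adj (sub_mat Phi n m 0 n) su sx \<and>
         in_S Adj (sub_mat Phi n m n p) su sy)"

definition structured_realizable ::
  "real mat \<Rightarrow> nat \<Rightarrow> (nat \<Rightarrow> nat) \<Rightarrow> (nat \<Rightarrow> nat) \<Rightarrow> rfun mat \<Rightarrow> bool" where
  "structured_realizable Adj N su sy K \<longleftrightarrow>
     (\<exists>nK sK AK BK CK DK.
        site_map N nK sK \<and>
        AK \<in> carrier_mat nK nK \<and> BK \<in> carrier_mat nK (dim_col K) \<and>
        CK \<in> carrier_mat (dim_row K) nK \<and> DK \<in> carrier_mat (dim_row K) (dim_col K) \<and>
        in_S Adj AK sK sK \<and> in_S Adj BK sK sy \<and> in_S Adj CK su sK \<and> in_S Adj DK su sy \<and>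
        K = rmat CK * resolvent AK * rmat BK + rmat DK)"

end

theory Submission
  imports Defs "Jordan_Normal_Form.Char_Poly" "HOL-Computational_Algebra.Polynomial_Factorial"
begin

text \<open>
  Write \<open>\<Phi>\<^sub>x\<^sub>x = R\<close>. Since \<open>K\<close> is proper, \<open>s R = I + P\<close> with \<open>P\<close> strictly proper, and eliminating
  the plant from the closed loop gives \<open>K = \<Phi>\<^sub>u\<^sub>y - (s \<Phi>\<^sub>u\<^sub>x) (I + P)\<^sup>-\<^sup>1 \<Phi>\<^sub>x\<^sub>y\<close>, where \<open>s \<Phi>\<^sub>u\<^sub>x\<close> is proper and
  \<open>\<Phi>\<^sub>x\<^sub>y\<close> strictly proper. So \<open>u = K y\<close> is computed by the loop \<open>\<beta> = \<Phi>\<^sub>x\<^sub>y y - P \<beta>\<close>,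
  \<open>u = \<Phi>\<^sub>u\<^sub>y y - (s \<Phi>\<^sub>u\<^sub>x) \<beta>\<close>, all of whose blocks are structured. Realize them jointly, placing each state
  at the site of the output row it contributes to, so that \<open>\<beta>\<close> is read off the states by a site-diagonal
  matrix. As \<open>P\<close> and \<open>\<Phi>\<^sub>x\<^sub>y\<close> have no feedthrough, closing the loop only multiplies structured
  matrices by this site-diagonal one, which preserves the structure even though \<open>\<A>\<close> need not be transitive.
\<close>

section \<open>Constants and polynomials inside the field of rational functions\<close>

interpretation to_fract_hom: comm_ring_hom "to_fract :: real poly \<Rightarrow> rfun"
  by unfold_locales simp_all

interpretation const_rf_hom: comm_ring_hom const_rf
  by unfold_locales
    (simp_all add: const_rf_def mult.commute flip: Zero_fract_def One_fract_def one_pCons)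

lemma s_var_neq_0 [simp]: "s_var \<noteq> 0"
  by (simp add: s_var_def Zero_fract_def eq_fract)

lemma s_var_power: "s_var ^ k = Fract (monom 1 k) 1"
  by (induction k) (auto simp: s_var_def One_fract_def one_pCons monom_0 monom_Suc)

lemma to_fract_monom: "to_fract (monom c k) = const_rf c * s_var ^ k"
  by (simp add: to_fract_def s_var_power const_rf_def smult_monom)

text \<open>The free bound \<open>d\<close> lets a numerator and a denominator of different degree
  be expanded over matching ranges of powers.\<close>

lemma to_fract_eq_sum_coeffs:
  assumes "degree p < d"
  shows "to_fract p = (\<Sum>j<d. const_rf (coeff p j) * s_var ^ j)"
proof -
  have "p = (\<Sum>j\<le>d-1. monom (coeff p j) j)"
    using assms by (intro poly_as_sum_of_monoms'[symmetric]) auto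
  also have "{..d-1} = {..<d}"
    using assms by auto
  finally have "to_fract p = to_fract (\<Sum>j<d. monom (coeff p j) j)"
    by simp
  thus ?thesis
    by (simp only: to_fract_hom.hom_sum to_fract_monom)
qed

subsection \<open>Proper rational functions\<close>

lemma proper_rf_const [simp]: "proper_rf (const_rf c)"
  unfolding proper_rf_def const_rf_def by (rule exI[of _ "[:c:]"], rule exI[of _ 1]) auto

lemma proper_rf_0 [simp]: "proper_rf 0" and proper_rf_1 [simp]: "proper_rf 1"
  using proper_rf_const[of 0] proper_rf_const[of 1] by simp_all

lemma proper_rf_mult:
  assumes "proper_rf f" "proper_rf g"
  shows "proper_rf (f * g)"
proof -
  obtain p q p' q' where "q \<noteq> 0" "degree p \<le> degree q" "f = Fract p q"
    "q' \<noteq> 0" "degree p' \<le> degree q'" "g = Fract p' q'"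
    using assms unfolding proper_rf_def by blast
  moreover have "degree (p * p') \<le> degree (q * q')"
    using calculation degree_mult_le[of p p'] by (simp add: degree_mult_eq)
  ultimately show ?thesis
    unfolding proper_rf_def by (intro exI[of _ "p * p'"] exI[of _ "q * q'"]) simp
qed

lemma proper_rf_add:
  assumes "proper_rf f" "proper_rf g"
  shows "proper_rf (f + g)"
proof -
  obtain p q p' q' where *: "q \<noteq> 0" "degree p \<le> degree q" "f = Fract p q"
    "q' \<noteq> 0" "degree p' \<le> degree q'" "g = Fract p' q'"
    using assms unfolding proper_rf_def by blast
  have "degree (p * q' + p' * q) \<le> degree (q * q')"
    using * degree_mult_le[of p q'] degree_mult_le[of p' q]
    by (intro degree_add_le) (simp_all add: degree_mult_eq)
  with * show ?thesis
    unfolding proper_rf_def by (intro exI[of _ "p * q' + p' * q"] exI[of _ "q * q'"]) simp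
qed

lemma proper_rf_sum: "(\<And>i. i \<in> I \<Longrightarrow> proper_rf (f i)) \<Longrightarrow> proper_rf (sum f I)"
  by (induction I rule: infinite_finite_induct) (auto intro: proper_rf_add)

lemma proper_rf_inverse_s_var [simp]: "proper_rf (inverse s_var)"
  unfolding proper_rf_def s_var_def
  by (rule exI[of _ 1], rule exI[of _ "[:0,1:]"]) simp

lemma proper_rf_inverse_s_var_power [simp]: "proper_rf (inverse s_var ^ k)"
  by (induction k) (auto intro: proper_rf_mult)

text \<open>Properness of \<open>s_var * f\<close> serves throughout as the encoding of strict
  properness of \<open>f\<close>.\<close>

lemma proper_rf_cancel_s_var: "proper_rf (s_var * f) \<Longrightarrow> proper_rf f"
  using proper_rf_mult[OF proper_rf_inverse_s_var, of "s_var * f"]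
  by (simp flip: mult.assoc)

text \<open>Dividing by \<open>s_var\<close> as often as the degree of the numerator lifts the
  denominator to at least that degree.\<close>

lemma ex_inverse_s_var_power_proper: "\<exists>k. proper_rf (inverse s_var ^ k * f)"
proof (cases f rule: Fract_cases)
  case (Fract p q)
  have "inverse s_var ^ degree p * f = Fract p (monom 1 (degree p) * q)"
    using Fract by (simp add: power_inverse s_var_power)
  moreover have "degree p \<le> degree (monom 1 (degree p) * q)" "monom 1 (degree p) * q \<noteq> 0"
    using Fract by (simp_all add: degree_mult_eq degree_monom_eq)
  ultimately show ?thesis
    unfolding proper_rf_def by metis
qed

text \<open>If \<open>s\<^sup>-\<^sup>k V\<close> is proper with \<open>k > 0\<close> minimal, the fixed-point equation exhibits it as
  strictly proper, contradicting minimality.\<close>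

lemma proper_rf_fixed_point:
  fixes V H E :: "'i \<Rightarrow> 'i \<Rightarrow> rfun"
  assumes fin: "finite I"
    and H: "\<And>i j. i \<in> I \<Longrightarrow> j \<in> I \<Longrightarrow> proper_rf (H i j)"
    and E: "\<And>i j. i \<in> I \<Longrightarrow> j \<in> I \<Longrightarrow> proper_rf (E i j)"
    and V: "\<And>i j. i \<in> I \<Longrightarrow> j \<in> I \<Longrightarrow> V i j = E i j + inverse s_var * (\<Sum>l\<in>I. H i l * V l j)"
    and ij: "i \<in> I" "j \<in> I"
  shows "proper_rf (V i j)"
proof -
  define P where "P k \<longleftrightarrow> (\<forall>i\<in>I. \<forall>j\<in>I. proper_rf (inverse s_var ^ k * V i j))" for k
  \<comment> \<open>The factor \<open>inverse s_var\<close> in front of the sum raises its exponent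
    from \<open>k\<close> to \<open>Suc k\<close>, where the assumption applies.\<close>
  have step: "P k" if "P (Suc k)" for k
    unfolding P_def
  proof (intro ballI)
    fix i j assume ij: "i \<in> I" "j \<in> I"
    have "inverse s_var ^ k * V i j =
        inverse s_var ^ k * E i j + (\<Sum>l\<in>I. H i l * (inverse s_var ^ Suc k * V l j))"
      by (subst V[OF ij]) (simp add: algebra_simps sum_distrib_left)
    also have "proper_rf \<dots>"
      using that ij unfolding P_def
      by (intro proper_rf_add proper_rf_sum proper_rf_mult[OF H] proper_rf_mult[OF _ E])
        (auto simp del: power_Suc)
    finally show "proper_rf (inverse s_var ^ k * V i j)" .
  qed
  have "\<forall>i j. \<exists>k. proper_rf (inverse s_var ^ k * V i j)"
    using ex_inverse_s_var_power_proper by blast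
  then obtain k where k: "\<And>i j. proper_rf (inverse s_var ^ k i j * V i j)"
    by metis
  \<comment> \<open>The sum of the entrywise exponents bounds each of them, so one exponent serves
    all entries.\<close>
  define m where "m = (\<Sum>i\<in>I. \<Sum>j\<in>I. k i j)"
  have "P m"
    unfolding P_def
  proof (intro ballI)
    fix i j assume ij: "i \<in> I" "j \<in> I"
    have "k i j \<le> (\<Sum>j\<in>I. k i j)"
      using ij fin by (intro member_le_sum) auto
    also have "\<dots> \<le> m"
      unfolding m_def using ij fin by (intro member_le_sum[of i I "\<lambda>i. \<Sum>j\<in>I. k i j"]) auto
    finally have "inverse s_var ^ m * V i j =
        inverse s_var ^ (m - k i j) * (inverse s_var ^ k i j * V i j)"
      by (simp add: mult.assoc[symmetric] power_add[symmetric])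
    thus "proper_rf (inverse s_var ^ m * V i j)"
      using k by (simp only: proper_rf_mult proper_rf_inverse_s_var_power)
  qed
  hence "P 0"
    by (induction m) (auto intro: step)
  thus ?thesis
    using ij by (simp add: P_def)
qed

text \<open>The product of the denominators, each normalised to be monic, is common to all. Positive
  degree guarantees at least one state in the observer form below.\<close>

lemma common_monic_denominator:
  assumes "finite I" "\<And>i. i \<in> I \<Longrightarrow> proper_rf (f i)"
  shows "\<exists>q. lead_coeff q = 1 \<and> degree q > 0 \<and>
    (\<forall>i\<in>I. \<exists>p. degree p \<le> degree q \<and> f i = Fract p q)"
  using assms
proof (induction I rule: finite_induct)
  case empty
  \<comment> \<open>The product starts from \<open>s\<close> instead of 1, so its degree is positive
    from the outset.\<close>
  show ?case by (rule exI[of _ "[:0,1:]"]) simp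
next
  case (insert i I)
  then obtain q where q: "lead_coeff q = 1" "degree q > 0"
    "\<And>i. i \<in> I \<Longrightarrow> \<exists>p. degree p \<le> degree q \<and> f i = Fract p q"
    by auto
  obtain p0 q0 where 0: "q0 \<noteq> 0" "degree p0 \<le> degree q0" "f i = Fract p0 q0"
    using insert.prems unfolding proper_rf_def by blast
  define c where "c = inverse (lead_coeff q0)"
  have c: "c \<noteq> 0" "c * lead_coeff q0 = 1"
    using 0 by (auto simp: c_def)
  have nz: "q \<noteq> 0"
    using q by auto
  define Q where "Q = q * Polynomial.smult c q0"
  have degQ: "degree Q = degree q + degree q0"
    using nz 0 c by (simp add: Q_def degree_mult_eq)
  have "lead_coeff Q = 1"
    using q c unfolding Q_def lead_coeff_mult lead_coeff_smult by simp
  moreover have "degree Q > 0"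
    using degQ q by simp
  moreover have "\<exists>p. degree p \<le> degree Q \<and> f j = Fract p Q" if j: "j \<in> insert i I" for j
  proof (cases "j = i")
    case True
    have "f j = Fract (q * Polynomial.smult c p0) Q"
      using True 0 nz c by (simp add: Q_def eq_fract mult_ac)
    moreover have "degree (q * Polynomial.smult c p0) \<le> degree Q"
      using degQ 0 c degree_mult_le[of q "Polynomial.smult c p0"] by simp
    ultimately show ?thesis by blast
  next
    case False
    then obtain p where p: "degree p \<le> degree q" "f j = Fract p q"
      using q(3)[of j] j by auto
    have "f j = Fract (p * Polynomial.smult c q0) Q"
      using p 0 nz c by (simp add: Q_def eq_fract mult_ac)
    moreover have "degree (p * Polynomial.smult c q0) \<le> degree Q"
      using degQ p c degree_mult_le[of p "Polynomial.smult c q0"] by simp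
    ultimately show ?thesis by blast
  qed
  ultimately show ?case by blast
qed

text \<open>Clearing denominators in s p / q = p' / q' gives 1 + deg p + deg q' = deg p' + deg q,
  where deg p' \<le> deg q'. Positive degree of \<open>q\<close> settles \<open>p = 0\<close>, whose
  degree is 0.\<close>

lemma strictly_proper_imp_degree_less:
  assumes "proper_rf (s_var * Fract p q)" "q \<noteq> 0" "degree q > 0"
  shows "degree p < degree q"
proof (cases "p = 0")
  case False
  obtain p' q' where *: "q' \<noteq> 0" "degree p' \<le> degree q'" "s_var * Fract p q = Fract p' q'"
    using assms unfolding proper_rf_def by blast
  have eq: "[:0,1:] * p * q' = p' * q"
    using * assms by (simp add: s_var_def eq_fract)
  hence "p' \<noteq> 0"
    using False * by auto
  have "degree ([:0,1:] * p * q') = 1 + degree p + degree q'"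
    using False * by (subst degree_mult_eq) (auto simp: degree_mult_eq)
  moreover have "degree (p' * q) = degree p' + degree q"
    using \<open>p' \<noteq> 0\<close> assms by (simp add: degree_mult_eq)
  ultimately show ?thesis
    using *(2) unfolding eq by linarith
qed (use assms in simp)

subsection \<open>Observer canonical form\<close>

text \<open>The equations determine the chain of integrators \<open>x\<close> from the output
  \<open>y\<close>; that the chain ends in \<open>y\<close> itself is the identity q y = p. The
  coefficients of \<open>p\<close> enter only as inputs, so one chain can serve several numerators
  over \<open>q\<close>.\<close>

lemma observer_form:
  assumes q: "lead_coeff q = 1" and d: "degree q = Suc d" and p: "degree p < Suc d"
  defines "y \<equiv> Fract p q"
  shows "\<exists>x. x d = y \<and> (\<forall>k\<le>d. s_var * x k =
    (if k = 0 then 0 else x (k - 1)) - const_rf (coeff q k) * y + const_rf (coeff p k))"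
proof -
  define g where "g k = const_rf (coeff p k) - const_rf (coeff q k) * y" for k
  define x where "x = rec_nat (inverse s_var * g 0) (\<lambda>k r. inverse s_var * (r + g (Suc k)))"
  have x0: "s_var * x 0 = g 0" and xS: "s_var * x (Suc k) = x k + g (Suc k)" for k
    by (simp_all add: x_def flip: mult.assoc)
  \<comment> \<open>Clearing the divisions by \<open>s_var\<close> turns the recursion into a
    Horner-type sum.\<close>
  have closed_form: "s_var ^ Suc k * x k = (\<Sum>j<Suc k. g j * s_var ^ j)" for k
  proof (induction k)
    case 0
    show ?case using x0 by simp
  next
    case (Suc k)
    have "s_var ^ Suc (Suc k) * x (Suc k) = s_var ^ Suc k * (s_var * x (Suc k))"
      by (simp add: mult_ac)
    also have "\<dots> = s_var ^ Suc k * x k + g (Suc k) * s_var ^ Suc k"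
      by (simp only: xS algebra_simps)
    finally show ?case
      using Suc by simp
  qed
  have "q \<noteq> 0"
    using d by auto
  have coeff_d: "coeff q (Suc d) = 1"
    using q d by simp
  have "to_fract q * y = to_fract p"
    using \<open>q \<noteq> 0\<close> by (simp add: y_def to_fract_def eq_fract)
  moreover have "to_fract q = (\<Sum>j<Suc d. const_rf (coeff q j) * s_var ^ j) + s_var ^ Suc d"
    using to_fract_eq_sum_coeffs[of q "Suc (Suc d)"] d coeff_d by simp
  ultimately have "(\<Sum>j<Suc d. const_rf (coeff p j) * s_var ^ j) =
      (\<Sum>j<Suc d. const_rf (coeff q j) * s_var ^ j) * y + s_var ^ Suc d * y"
    using to_fract_eq_sum_coeffs[OF p] by (simp only: distrib_right)
  \<comment> \<open>The closed form at \<open>d\<close> is p minus the lower terms of q times y;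
    since q is monic, only its top term times y remains.\<close>
  hence "s_var ^ Suc d * x d = s_var ^ Suc d * y"
    unfolding closed_form g_def left_diff_distrib sum_subtractf
    by (simp add: sum_distrib_right sum_distrib_left mult_ac del: sum.lessThan_Suc)
  hence "x d = y"
    by simp
  moreover have "s_var * x k = (if k = 0 then 0 else x (k - 1)) + g k" for k
    by (cases k) (use x0 xS in auto)
  ultimately show ?thesis
    by (intro exI[of _ x]) (simp add: g_def)
qed

text \<open>One observer chain per row of \<open>T\<close>, over a common denominator. Dynamics and
  read-out depend on the denominator alone, so all columns share the chain of a row and act only
  through numerator coefficients. Hence \<open>A\<close> links only states of one row, while
  \<open>B\<close> and \<open>D\<close> inherit the zeros of \<open>T\<close>. \<open>X\<close> is
  the response of the states to the inputs, and \<open>\<rho>\<close> gives the row a state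
  serves.\<close>

lemma row_located_realization:
  fixes T :: "nat \<Rightarrow> nat \<Rightarrow> rfun"
  assumes T: "\<And>a b. a < r \<Longrightarrow> b < c \<Longrightarrow> proper_rf (T a b)"
  obtains nK :: nat and \<rho> :: "nat \<Rightarrow> nat" and A B C D :: "nat \<Rightarrow> nat \<Rightarrow> real"
    and X :: "nat \<Rightarrow> nat \<Rightarrow> rfun" where
    "\<And>i. i < nK \<Longrightarrow> \<rho> i < r"
    "\<And>i j. i < nK \<Longrightarrow> j < nK \<Longrightarrow> A i j \<noteq> 0 \<Longrightarrow> \<rho> i = \<rho> j"
    "\<And>i b. i < nK \<Longrightarrow> b < c \<Longrightarrow> B i b \<noteq> 0 \<Longrightarrow> T (\<rho> i) b \<noteq> 0"
    "\<And>a i. a < r \<Longrightarrow> i < nK \<Longrightarrow> C a i \<noteq> 0 \<Longrightarrow> \<rho> i = a"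
    "\<And>a b. a < r \<Longrightarrow> b < c \<Longrightarrow> D a b \<noteq> 0 \<Longrightarrow> \<not> proper_rf (s_var * T a b)"
    "\<And>i b. i < nK \<Longrightarrow> b < c \<Longrightarrow>
       s_var * X i b = (\<Sum>j<nK. const_rf (A i j) * X j b) + const_rf (B i b)"
    "\<And>a b. a < r \<Longrightarrow> b < c \<Longrightarrow> T a b = (\<Sum>i<nK. const_rf (C a i) * X i b) + const_rf (D a b)"
proof -
  have "\<exists>q. lead_coeff q = 1 \<and> degree q > 0 \<and>
    (\<forall>ab\<in>{..<r}\<times>{..<c}. \<exists>p. degree p \<le> degree q \<and> T (fst ab) (snd ab) = Fract p q)"
    using T by (intro common_monic_denominator) auto
  then obtain q where q: "lead_coeff q = 1" "degree q > 0"
    "\<And>a b. a < r \<Longrightarrow> b < c \<Longrightarrow> \<exists>p. degree p \<le> degree q \<and> T a b = Fract p q"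
    by force
  then obtain num where num:
    "\<And>a b. a < r \<Longrightarrow> b < c \<Longrightarrow> degree (num a b) \<le> degree q \<and> T a b = Fract (num a b) q"
    by metis
  obtain d where d: "degree q = Suc d"
    using q(2) by (cases "degree q") auto
  have q0: "q \<noteq> 0"
    using q by auto
  \<comment> \<open>As \<open>q\<close> is monic of degree \<open>Suc d\<close>, this coefficient is
    the value of the entry at infinity; subtracting that multiple of \<open>q\<close> leaves a
    numerator of smaller degree.\<close>
  define D where "D a b = coeff (num a b) (Suc d)" for a b
  define P where "P a b = num a b - Polynomial.smult (D a b) q" for a b
  have P_deg: "degree (P a b) < Suc d" if "a < r" "b < c" for a b
  proof -
    have "degree (P a b) \<le> Suc d"
      unfolding P_def using num[OF that] d
      by (intro degree_diff_le) (auto intro: order.trans[OF degree_smult_le])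
    moreover have "coeff (P a b) (Suc d) = 0"
      using q d by (simp add: P_def D_def)
    ultimately show ?thesis
      using eq_zero_or_degree_less by fastforce
  qed
  have T_eq: "T a b = Fract (P a b) q + const_rf (D a b)" if "a < r" "b < c" for a b
    using num[OF that] q0 by (simp add: P_def const_rf_def eq_fract algebra_simps)
  have "\<exists>x. x d = Fract (P a b) q \<and> (\<forall>k\<le>d. s_var * x k =
      (if k = 0 then 0 else x (k - 1)) - const_rf (coeff q k) * Fract (P a b) q
        + const_rf (coeff (P a b) k))" if "a < r" "b < c" for a b
    using observer_form[OF q(1) d P_deg[OF that]] .
  then obtain x where x: "\<And>a b. a < r \<Longrightarrow> b < c \<Longrightarrow> x a b d = Fract (P a b) q"
    "\<And>a b k. a < r \<Longrightarrow> b < c \<Longrightarrow> k \<le> d \<Longrightarrow> s_var * x a b k =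
      (if k = 0 then 0 else x a b (k - 1)) - const_rf (coeff q k) * Fract (P a b) q
        + const_rf (coeff (P a b) k)"
    by metis
  \<comment> \<open>Each row owns \<open>e\<close> consecutive states: state \<open>i\<close> has
    position \<open>i mod e\<close> in the chain of row \<open>i div e\<close>.\<close>
  define e where "e = Suc d"
  \<comment> \<open>A link from the predecessor, and output injection from the last state of the
    chain. The guard keeps the head of a chain from linking to the tail of the preceding
    one.\<close>
  define A where "A i j = (if i mod e \<noteq> 0 \<and> j = i - 1 then 1 else 0)
     - (if j = (i div e) * e + d then coeff q (i mod e) else 0)" for i j
  define B where "B i b = coeff (P (i div e) b) (i mod e)" for i b
  define C :: "nat \<Rightarrow> nat \<Rightarrow> real" where "C a i = (if i = a * e + d then 1 else 0)" for a i
  define X where "X i b = x (i div e) b (i mod e)" for i b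
  have row: "i div e < r" if "i < r * e" for i
    using that by (simp add: less_mult_imp_div_less)
  have last_div: "(a * e + d) div e = a" and last_mod: "(a * e + d) mod e = d" for a
    by (simp_all add: e_def div_mult_self3 mod_mult_self3 del: mult_Suc_right)
  have d_mod: "d mod e = d"
    by (simp add: e_def)
  have last_less: "a * e + d < r * e" if "a < r" for a
  proof -
    have "a * e + d < Suc a * e"
      by (simp add: e_def)
    also have "\<dots> \<le> r * e"
      using that by (intro mult_right_mono) auto
    finally show ?thesis .
  qed
  have pred_div: "(i - 1) div e = i div e" and pred_mod: "(i - 1) mod e = i mod e - 1"
    if "i mod e \<noteq> 0" for i
  proof -
    have "i - 1 = (i div e) * e + (i mod e - 1)"
      using that div_mult_mod_eq[of i e] by linarith
    moreover have "i mod e - 1 < e"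
      using mod_less_divisor[of e i] unfolding e_def by linarith
    ultimately show "(i - 1) div e = i div e" "(i - 1) mod e = i mod e - 1"
      by simp_all
  qed
  show thesis
  proof (rule that[where nK = "r * e" and \<rho> = "\<lambda>i. i div e" and A = A and B = B and C = C
        and D = D and X = X])
    fix i assume "i < r * e"
    thus "i div e < r" by (rule row)
  next
    fix i j assume "A i j \<noteq> 0"
    thus "i div e = j div e"
      using pred_div last_div by (auto simp: A_def split: if_splits)
  next
    fix i b assume "i < r * e" "b < c" "B i b \<noteq> 0"
    \<comment> \<open>A zero numerator would make \<open>D\<close>, then \<open>P\<close>, and so
      \<open>B\<close> vanish.\<close>
    moreover have "num (i div e) b \<noteq> 0"
      using calculation by (auto simp: B_def P_def D_def)
    ultimately show "T (i div e) b \<noteq> 0"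
      using num[OF row, of i b] q0 by (auto simp: Zero_fract_def eq_fract)
  next
    fix a i assume "C a i \<noteq> 0"
    thus "i div e = a"
      using last_div by (auto simp: C_def split: if_splits)
  next
    fix a b assume *: "a < r" "b < c" "D a b \<noteq> 0"
    show "\<not> proper_rf (s_var * T a b)"
    proof
      assume "proper_rf (s_var * T a b)"
      hence "degree (num a b) < degree q"
        using num[OF *(1,2)] q0 q(2) by (intro strictly_proper_imp_degree_less) auto
      thus False
        using * d by (simp add: D_def coeff_eq_0)
    qed
  next
    fix i b assume i: "i < r * e" and b: "b < c"
    have mod_le: "i mod e \<le> d"
      using mod_less_divisor[of e i] unfolding e_def by linarith
    \<comment> \<open>Split into two Kronecker deltas, so that the sum over \<open>j\<close>
      collapses; the guard also makes the truncated \<open>i - 1\<close> at \<open>i = 0\<close>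
      harmless.\<close>
    have "const_rf (A i j) * X j b =
        (if j = i - 1 then (if i mod e \<noteq> 0 then X j b else 0) else 0)
      - (if j = (i div e) * e + d then const_rf (coeff q (i mod e)) * X j b else 0)" for j
      by (simp add: A_def const_rf_hom.hom_minus left_diff_distrib)
    hence "(\<Sum>j<r*e. const_rf (A i j) * X j b) = (if i mod e \<noteq> 0 then X (i - 1) b else 0)
        - const_rf (coeff q (i mod e)) * X ((i div e) * e + d) b"
      using i last_less[OF row[OF i]] by (simp add: sum_subtractf)
    also have "\<dots> + const_rf (B i b) = s_var * X i b"
      using row[OF i] b pred_div[of i] pred_mod[of i] mod_le
      by (simp add: X_def B_def x last_div last_mod d_mod)
    finally show "s_var * X i b = (\<Sum>j<r*e. const_rf (A i j) * X j b) + const_rf (B i b)"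
      by simp
  next
    fix a b assume *: "a < r" "b < c"
    have "const_rf (C a i) * X i b = (if i = a * e + d then X i b else 0)" for i
      by (simp add: C_def)
    thus "T a b = (\<Sum>i<r*e. const_rf (C a i) * X i b) + const_rf (D a b)"
      using * last_less[of a] by (simp add: T_eq X_def last_div last_mod d_mod x)
  qed
qed

subsection \<open>Matrices of transfer functions\<close>

text \<open>Over a field a right inverse of a square matrix is two-sided, hence the unique object
  that \<open>inv_m\<close> describes.\<close>

lemma inv_m_eqI:
  assumes M: "M \<in> carrier_mat n n" and N: "N \<in> carrier_mat n n" and MN: "M * N = 1\<^sub>m n"
  shows "inv_m M = N"
proof -
  have NM: "N * M = 1\<^sub>m n"
    using mat_mult_left_right_inverse[OF M N MN] .
  have "dim_row M = n"
    using M by auto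
  show ?thesis
    unfolding inv_m_def \<open>dim_row M = n\<close>
  proof (rule the_equality)
    fix N' assume N': "N' \<in> carrier_mat n n \<and> M * N' = 1\<^sub>m n \<and> N' * M = 1\<^sub>m n"
    have "N' = N' * (M * N)"
      using N' MN by (simp add: right_mult_one_mat[of N' n n])
    also have "\<dots> = N' * M * N"
      by (rule assoc_mult_mat[symmetric]) (use N' M N in auto)
    finally show "N' = N"
      using N' N by simp
  qed (use MN NM N in auto)
qed

lemma rmat_carrier [simp]: "rmat M \<in> carrier_mat r c \<longleftrightarrow> M \<in> carrier_mat r c"
  by (simp add: rmat_def)

lemma s_minus_A_carrier [simp]:
  "A \<in> carrier_mat n n \<Longrightarrow> s_var \<cdot>\<^sub>m 1\<^sub>m n - rmat A \<in> carrier_mat n n"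
  by (intro minus_carrier_mat) simp

text \<open>The matrix sI - A is the characteristic matrix read over rational functions, so its
  determinant is the nonzero characteristic polynomial. A resolvent can thus be evaluated by
  exhibiting a solution of the state equation.\<close>

lemma resolvent_mult_eqI:
  assumes A: "A \<in> carrier_mat n n" and Z: "Z \<in> carrier_mat n k"
    and eq: "(s_var \<cdot>\<^sub>m 1\<^sub>m n - rmat A) * Z = B"
  shows "resolvent A \<in> carrier_mat n n" "resolvent A * B = Z"
proof -
  let ?F = "s_var \<cdot>\<^sub>m 1\<^sub>m n - rmat A"
  have F: "?F \<in> carrier_mat n n"
    using A by simp
  have "?F = map_mat to_fract (char_poly_matrix A)"
  proof (rule eq_matI)
    fix i j assume ij: "i < dim_row (map_mat to_fract (char_poly_matrix A))"
      "j < dim_col (map_mat to_fract (char_poly_matrix A))"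
    have neg: "to_fract [:- a:] = - const_rf a" for a
      by (simp add: to_fract_def const_rf_def)
    have diag: "to_fract (pCons (- a) 1) = s_var - const_rf a" for a
      by (simp add: to_fract_def const_rf_def s_var_def one_pCons)
    show "?F $$ (i, j) = map_mat to_fract (char_poly_matrix A) $$ (i, j)"
      using ij A by (auto simp: char_poly_matrix_def rmat_def neg diag simp del: to_fract_add)
  qed (use A in \<open>auto simp: char_poly_matrix_def rmat_def\<close>)
  hence "det ?F = to_fract (char_poly A)"
    by (simp add: char_poly_def)
  moreover have "char_poly A \<noteq> 0"
    using degree_monic_char_poly[OF A] by auto
  ultimately have "det ?F \<noteq> 0"
    by simp
  from det_non_zero_imp_unit[OF F this, of undefined]
  obtain G where G: "G \<in> carrier_mat n n" "G * ?F = 1\<^sub>m n" "?F * G = 1\<^sub>m n"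
    by (auto simp: Units_def ring_mat_simps)
  have "resolvent A = G"
    using A unfolding resolvent_def by (auto intro!: inv_m_eqI[OF F G(1,3), simplified])
  thus "resolvent A \<in> carrier_mat n n"
    using G by simp
  have "G * B = G * ?F * Z"
    unfolding eq[symmetric] by (rule assoc_mult_mat[symmetric, OF G(1) F Z])
  thus "resolvent A * B = Z"
    using G Z \<open>resolvent A = G\<close> by simp
qed

lemma rmat_dim [simp]: "dim_row (rmat M) = dim_row M" "dim_col (rmat M) = dim_col M"
  by (simp_all add: rmat_def)

lemma rmat_index [simp]: "i < dim_row M \<Longrightarrow> j < dim_col M \<Longrightarrow> rmat M $$ (i, j) = const_rf (M $$ (i, j))"
  by (simp add: rmat_def)

lemma rmat_mult: "A \<in> carrier_mat r k \<Longrightarrow> B \<in> carrier_mat k c \<Longrightarrow> rmat (A * B) = rmat A * rmat B"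
  unfolding rmat_def by (rule const_rf_hom.mat_hom_mult)

lemma rmat_minus:
  "A \<in> carrier_mat r c \<Longrightarrow> B \<in> carrier_mat r c \<Longrightarrow> rmat (A - B) = rmat A - rmat B"
  by (intro eq_matI) (auto simp: const_rf_hom.hom_minus)

lemma mult_mat_index:
  assumes "A \<in> carrier_mat r k" "B \<in> carrier_mat k c" "i < r" "j < c"
  shows "(A * B) $$ (i, j) = (\<Sum>l<k. A $$ (i, l) * B $$ (l, j))"
  using assms by (simp add: scalar_prod_def atLeast0LessThan)

lemma proper_tf_mult:
  assumes "A \<in> carrier_mat r k" "B \<in> carrier_mat k c" "proper_tf A" "proper_tf B"
  shows "proper_tf (A * B)"
  using assms unfolding proper_tf_def
  by (auto simp: scalar_prod_def intro!: proper_rf_sum proper_rf_mult)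

lemma proper_tf_add:
  assumes "A \<in> carrier_mat r c" "B \<in> carrier_mat r c" "proper_tf A" "proper_tf B"
  shows "proper_tf (A + B)"
  using assms unfolding proper_tf_def by (auto intro!: proper_rf_add)

lemma proper_tf_rmat [simp]: "proper_tf (rmat M)"
  by (simp add: proper_tf_def)

lemma proper_tf_one [simp]: "proper_tf (1\<^sub>m n)"
  by (auto simp: proper_tf_def)

lemma proper_tf_fixed_point:
  assumes V: "V \<in> carrier_mat n n" and H: "H \<in> carrier_mat n n" and "proper_tf H"
    and eq: "V = 1\<^sub>m n + inverse s_var \<cdot>\<^sub>m (H * V)"
  shows "proper_tf V"
  unfolding proper_tf_def
proof (intro allI impI)
  fix i j assume "i < dim_row V" "j < dim_col V"
  hence ij: "i \<in> {..<n}" "j \<in> {..<n}"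
    using V by auto
  show "proper_rf (V $$ (i, j))"
  proof (rule proper_rf_fixed_point[where I = "{..<n}" and H = "\<lambda>i j. H $$ (i, j)"
        and E = "\<lambda>i j. if i = j then 1 else 0" and V = "\<lambda>i j. V $$ (i, j)", OF _ _ _ _ ij])
    fix i j assume ij: "i \<in> {..<n}" "j \<in> {..<n}"
    have "V $$ (i, j) = (1\<^sub>m n + inverse s_var \<cdot>\<^sub>m (H * V)) $$ (i, j)"
      using eq by simp
    also have "\<dots> = (if i = j then 1 else 0) + inverse s_var * (H * V) $$ (i, j)"
      using ij V H by simp
    also have "(H * V) $$ (i, j) = (\<Sum>l<n. H $$ (i, l) * V $$ (l, j))"
      using ij by (intro mult_mat_index[OF H V]) auto
    finally show "V $$ (i, j) = (if i = j then 1 else 0) +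
        inverse s_var * (\<Sum>l<n. H $$ (i, l) * V $$ (l, j))" .
  qed (use assms in \<open>auto simp: proper_tf_def\<close>)
qed

section \<open>Block matrices and feedback interconnections\<close>

lemma sub_mat_carrier [simp]: "sub_mat M r0 nr c0 nc \<in> carrier_mat nr nc"
  by (simp add: sub_mat_def)

lemma four_block_sub_mat:
  assumes "M \<in> carrier_mat (n + m) (k + p)"
  shows "four_block_mat (sub_mat M 0 n 0 k) (sub_mat M 0 n k p) (sub_mat M n m 0 k) (sub_mat M n m k p)
    = M"
  using assms by (intro eq_matI) (auto simp: sub_mat_def)

lemma four_block_mat_inject:
  assumes c: "A \<in> carrier_mat r1 c1" "B \<in> carrier_mat r1 c2" "C \<in> carrier_mat r2 c1" "D \<in> carrier_mat r2 c2"
    and c': "A' \<in> carrier_mat r1 c1" "B' \<in> carrier_mat r1 c2" "C' \<in> carrier_mat r2 c1" "D' \<in> carrier_mat r2 c2"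
    and eq: "four_block_mat A B C D = four_block_mat A' B' C' D'"
  shows "A = A'" "B = B'" "C = C'" "D = D'"
proof -
  have sub: "sub_mat (four_block_mat A B C D) 0 r1 0 c1 = A"
    "sub_mat (four_block_mat A B C D) 0 r1 c1 c2 = B"
    "sub_mat (four_block_mat A B C D) r1 r2 0 c1 = C"
    "sub_mat (four_block_mat A B C D) r1 r2 c1 c2 = D"
    if "A \<in> carrier_mat r1 c1" "B \<in> carrier_mat r1 c2" "C \<in> carrier_mat r2 c1" "D \<in> carrier_mat r2 c2"
    for A B C D :: "'a mat"
    using that by (auto intro!: eq_matI simp: sub_mat_def)
  show "A = A'" "B = B'" "C = C'" "D = D'"
    using sub[OF c] sub[OF c'] eq by simp_all
qed

lemma neg_add_mat_eqD:
  fixes X Y Z :: "'a :: ab_group_add mat"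
  assumes "X \<in> carrier_mat r c" "Y \<in> carrier_mat r c" "- X + Y = Z"
  shows "Y = Z + X"
  using assms by (intro eq_matI) auto

text \<open>In the application \<open>G\<close> is K C2. The first block column yields
  \<open>M\<close> and (F - B G) R = I; the second yields \<open>L\<close> and (F - B G) N = B K,
  which \<open>R\<close> solves.\<close>

lemma feedback_block_equations:
  fixes F :: "'a :: field mat"
  assumes F: "F \<in> carrier_mat n n" and B: "B \<in> carrier_mat n m" and G: "G \<in> carrier_mat m n"
    and K: "K \<in> carrier_mat m p"
    and R: "R \<in> carrier_mat n n" and N: "N \<in> carrier_mat n p"
    and M: "M \<in> carrier_mat m n" and L: "L \<in> carrier_mat m p"
    and eq: "four_block_mat F (- B) (- G) (1\<^sub>m m) * four_block_mat R N M L =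
      four_block_mat (1\<^sub>m n) (0\<^sub>m n p) (0\<^sub>m m n) K"
  shows "F * R = 1\<^sub>m n + B * G * R" "M = G * R" "N = R * (B * K)" "L = K + G * N"
proof -
  have "four_block_mat (F * R + - B * M) (F * N + - B * L)
      (- G * R + 1\<^sub>m m * M) (- G * N + 1\<^sub>m m * L) = four_block_mat (1\<^sub>m n) (0\<^sub>m n p) (0\<^sub>m m n) K"
    using mult_four_block_mat[of F n n "- B" m "- G" m "1\<^sub>m m" R n N p M L] assms by simp
  note e = four_block_mat_inject[OF _ _ _ _ _ _ _ _ this, of n n p m]
  have e1: "F * R + - B * M = 1\<^sub>m n" and e2: "F * N + - B * L = 0\<^sub>m n p"
    and e3: "- G * R + 1\<^sub>m m * M = 0\<^sub>m m n" and e4: "- G * N + 1\<^sub>m m * L = K"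
    using e assms by auto
  have "M = 0\<^sub>m m n + G * R"
    using e3 assms by (intro neg_add_mat_eqD[of _ m n]) (auto simp: uminus_mult_left_mat)
  thus M_eq: "M = G * R"
    using assms by simp
  show L_eq: "L = K + G * N"
    using e4 assms by (intro neg_add_mat_eqD[of _ m p]) (auto simp: uminus_mult_left_mat)
  have "- (B * M) + F * R = 1\<^sub>m n"
    using e1 assms comm_add_mat[of "F * R" n n "- (B * M)"] by (simp add: uminus_mult_left_mat)
  hence "F * R = 1\<^sub>m n + B * M"
    using assms by (intro neg_add_mat_eqD[of _ n n]) auto
  thus FR: "F * R = 1\<^sub>m n + B * G * R"
    using assms by (simp add: M_eq assoc_mult_mat[of B n m G n R n])
  have "- (B * L) + F * N = 0\<^sub>m n p"
    using e2 assms comm_add_mat[of "F * N" n p "- (B * L)"] by (simp add: uminus_mult_left_mat)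
  hence "F * N = 0\<^sub>m n p + B * L"
    using assms by (intro neg_add_mat_eqD[of _ n p]) auto
  hence FN: "F * N = B * K + B * G * N"
    using assms by (simp add: L_eq mult_add_distrib_mat[of B n m K p] assoc_mult_mat[of B n m G n N p])
  \<comment> \<open>\<open>R\<close> is a right inverse of the square matrix \<open>S\<close>, hence
    also a left inverse, and cancels \<open>S\<close> in S N = B K.\<close>
  define S where "S = F - B * G"
  have S: "S \<in> carrier_mat n n"
    using assms by (auto simp: S_def)
  have "S * R = F * R - B * G * R"
    unfolding S_def by (rule minus_mult_distrib_mat) (use assms in auto)
  also have "\<dots> = 1\<^sub>m n"
    unfolding FR using assms by (intro eq_matI) auto
  finally have RS: "R * S = 1\<^sub>m n"
    by (rule mat_mult_left_right_inverse[OF S R])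
  have "S * N = F * N - B * G * N"
    unfolding S_def by (rule minus_mult_distrib_mat) (use assms in auto)
  also have "\<dots> = B * K"
    unfolding FN using assms by (intro eq_matI) auto
  finally have "R * (B * K) = R * S * N"
    using assoc_mult_mat[OF R S N] by simp
  thus "N = R * (B * K)"
    using N RS by simp
qed

text \<open>\<open>X1\<close> and \<open>Xy\<close> are the state responses to two inputs. The first
  output, read by \<open>C1\<close>, has no feedthrough, so feeding its negative into the first
  input is pure state feedback, with no algebraic loop to solve.\<close>

lemma feedback_realization:
  fixes F :: "'a :: field mat"
  assumes F: "F \<in> carrier_mat k k" and B1: "B1 \<in> carrier_mat k n" and By: "By \<in> carrier_mat k p"
    and C1: "C1 \<in> carrier_mat n k" and Cu: "Cu \<in> carrier_mat m k"
    and Du1: "Du1 \<in> carrier_mat m n" and Duy: "Duy \<in> carrier_mat m p"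
    and X1: "X1 \<in> carrier_mat k n" and Xy: "Xy \<in> carrier_mat k p"
    and \<beta>: "\<beta> \<in> carrier_mat n p"
    and FX1: "F * X1 = B1" and FXy: "F * Xy = By"
    and fp: "\<beta> + C1 * X1 * \<beta> = C1 * Xy"
  defines "Z \<equiv> Xy - X1 * \<beta>"
  shows "(F + B1 * C1) * Z = By"
    "(Cu - Du1 * C1) * Z + Duy = (Cu * Xy + Duy) - (Cu * X1 + Du1) * \<beta>"
proof -
  note carr = F B1 By C1 Cu Du1 Duy X1 Xy \<beta>
  have Z: "Z \<in> carrier_mat k p" and X1\<beta>: "X1 * \<beta> \<in> carrier_mat k p"
    using carr by (auto simp: Z_def)
  have mult_Z: "Q * Z = Q * Xy - Q * X1 * \<beta>" if Q: "Q \<in> carrier_mat r k" for Q r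
    unfolding Z_def using mult_minus_distrib_mat[OF Q Xy X1\<beta>] assoc_mult_mat[OF Q X1 \<beta>] by simp
  \<comment> \<open>The fixed-point equation says that \<beta> is what \<open>C1\<close> reads off
    the closed-loop state \<open>Z\<close>, so \<beta> can be replaced by \<open>C1 * Z\<close>
    everywhere.\<close>
  have C1Z: "C1 * Z = \<beta>"
    unfolding mult_Z[OF C1] fp[symmetric] using carr by (intro eq_matI) auto
  have "(F + B1 * C1) * Z = F * Z + B1 * C1 * Z"
    by (rule add_mult_distrib_mat) (use carr Z in auto)
  also have "B1 * C1 * Z = B1 * \<beta>"
    using assoc_mult_mat[OF B1 C1 Z] C1Z by simp
  also have "F * Z + B1 * \<beta> = By"
    unfolding mult_Z[OF F] FX1 FXy using carr by (intro eq_matI) auto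
  finally show "(F + B1 * C1) * Z = By" .
  have "(Cu - Du1 * C1) * Z = Cu * Z - Du1 * C1 * Z"
    by (rule minus_mult_distrib_mat) (use carr Z in auto)
  also have "Du1 * C1 * Z = Du1 * \<beta>"
    using assoc_mult_mat[OF Du1 C1 Z] C1Z by simp
  finally have 1: "(Cu - Du1 * C1) * Z = Cu * Xy - Cu * X1 * \<beta> - Du1 * \<beta>"
    unfolding mult_Z[OF Cu] .
  have 2: "(Cu * X1 + Du1) * \<beta> = Cu * X1 * \<beta> + Du1 * \<beta>"
    by (rule add_mult_distrib_mat) (use carr in auto)
  have carr': "Cu * Xy \<in> carrier_mat m p" "Cu * X1 * \<beta> \<in> carrier_mat m p" "Du1 * \<beta> \<in> carrier_mat m p"
    using carr by auto
  have regroup: "Q - U - W + Duy = Q + Duy - (U + W)"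
    if "Q \<in> carrier_mat m p" "U \<in> carrier_mat m p" "W \<in> carrier_mat m p" for Q U W
    using that Duy by (intro eq_matI) auto
  show "(Cu - Du1 * C1) * Z + Duy = (Cu * Xy + Duy) - (Cu * X1 + Du1) * \<beta>"
    unfolding 1 2 by (rule regroup[OF carr'])
qed

section \<open>Entrywise realization equations in matrix form\<close>

lemma state_equation_mat:
  assumes "\<And>i b. i < k \<Longrightarrow> b < c \<Longrightarrow>
      s_var * X i b = (\<Sum>j<k. const_rf (A i j) * X j b) + const_rf (B i b)"
  shows "(s_var \<cdot>\<^sub>m 1\<^sub>m k - rmat (mat k k (\<lambda>(i, j). A i j))) * mat k c (\<lambda>(i, b). X i b) =
    rmat (mat k c (\<lambda>(i, b). B i b))" (is "?F * ?X = ?B")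
proof (rule eq_matI)
  fix i b assume "i < dim_row ?B" "b < dim_col ?B"
  hence ib: "i < k" "b < c" by auto
  have "(?F * ?X) $$ (i, b) = (\<Sum>j<k. ?F $$ (i, j) * ?X $$ (j, b))"
    using ib by (intro mult_mat_index) auto
  also have "\<dots> = (\<Sum>j<k. (if j = i then s_var * X j b else 0) - const_rf (A i j) * X j b)"
    using ib by (intro sum.cong) (auto simp: left_diff_distrib)
  also have "\<dots> = s_var * X i b - (\<Sum>j<k. const_rf (A i j) * X j b)"
    using ib by (simp add: sum_subtractf)
  finally show "(?F * ?X) $$ (i, b) = ?B $$ (i, b)"
    using assms[OF ib] ib by simp
qed auto

lemma output_equation_mat:
  assumes "T \<in> carrier_mat r c"
    and "\<And>a b. a < r \<Longrightarrow> b < c \<Longrightarrow>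
      T $$ (a, b) = (\<Sum>i<k. const_rf (C a i) * X i b) + const_rf (D a b)"
  shows "T = rmat (mat r k (\<lambda>(a, i). C a i)) * mat k c (\<lambda>(i, b). X i b) +
    rmat (mat r c (\<lambda>(a, b). D a b))"
  using assms by (intro eq_matI) (auto simp: scalar_prod_def atLeast0LessThan)

theorem theorem1:
  fixes N n m p nw nz :: nat
    and Adj :: "real mat"
    and A B1 B2 C1 D12 C2 D21 :: "real mat"
    and sx su sy :: "nat \<Rightarrow> nat"
    and K :: "rfun mat"
  assumes Adj_dim: "Adj \<in> carrier_mat N N"
    and Adj_01: "\<forall>i<N. \<forall>j<N. Adj $$ (i,j) = 0 \<or> Adj $$ (i,j) = 1"
    and Adj_diag: "\<forall>i<N. Adj $$ (i,i) = 1"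
    and plant: "A \<in> carrier_mat n n" "B1 \<in> carrier_mat n nw" "B2 \<in> carrier_mat n m"
               "C1 \<in> carrier_mat nz n" "D12 \<in> carrier_mat nz m"
               "C2 \<in> carrier_mat p n" "D21 \<in> carrier_mat p nw"
    and sites: "site_map N n sx" "site_map N m su" "site_map N p sy"
    and K_dim: "K \<in> carrier_mat m p"
    and K_proper: "proper_tf K"
    and wp: "well_posed A B2 C2 K"
    and cl: "cl_TF_structured Adj A B2 C2 sx su sy K"
  shows "structured_realizable Adj N su sy K"
proof -

  \<comment> \<open>The closed-loop blocks and the equations between them\<close>
  let ?s1 = "s_var \<cdot>\<^sub>m 1\<^sub>m n"
  define F where "F = ?s1 - rmat A"
  define G where "G = K * rmat C2"
  define W where "W = four_block_mat (1\<^sub>m n) (0\<^sub>m n p) (0\<^sub>m m n) K"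
  define Phi where "Phi = closed_loop_map A B2 C2 K"
  define R where "R = sub_mat Phi 0 n 0 n"
  define Nm where "Nm = sub_mat Phi 0 n n p"
  define M where "M = sub_mat Phi n m 0 n"
  define L where "L = sub_mat Phi n m n p"
  have dims: "dim_row A = n" "dim_col B2 = m" "dim_row C2 = p"
    using plant by auto
  have F: "F \<in> carrier_mat n n" and B: "rmat B2 \<in> carrier_mat n m" and G: "G \<in> carrier_mat m n"
    and W: "W \<in> carrier_mat (n + m) (n + p)"
    using plant K_dim by (auto simp: F_def G_def W_def)
  have R: "R \<in> carrier_mat n n" and Nm: "Nm \<in> carrier_mat n p"
    and M: "M \<in> carrier_mat m n" and L: "L \<in> carrier_mat m p"
    by (simp_all add: R_def Nm_def M_def L_def)
  have BK: "rmat B2 * K \<in> carrier_mat n p" and BG: "rmat B2 * G \<in> carrier_mat n n"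
    using B K_dim G by auto

  let ?loop = "four_block_mat F (- rmat B2) (- G) (1\<^sub>m m)"
  have loop_eq: "loop_mat A B2 C2 K = ?loop"
    by (simp add: loop_mat_def dims F_def G_def)
  have loop: "?loop \<in> carrier_mat (n + m) (n + m)"
    using F by auto
  obtain V where V: "?loop * V = 1\<^sub>m (n + m)" "V * ?loop = 1\<^sub>m (dim_row V)"
    using wp loop unfolding well_posed_def loop_eq invertible_mat_def inverts_mat_def by auto
  \<comment> \<open>Invertibility does not state the shape of the inverse; it is read off the two
    products.\<close>
  have "dim_col (?loop * V) = n + m" "dim_col (V * ?loop) = dim_row V"
    using V by simp_all
  hence Vc: "V \<in> carrier_mat (n + m) (n + m)"
    using F by auto
  have Phi_eq: "Phi = V * W"
    unfolding Phi_def closed_loop_map_def loop_eq inv_m_eqI[OF loop Vc V(1)] W_def dims ..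
  have "?loop * Phi = W"
    unfolding Phi_eq using assoc_mult_mat[OF loop Vc W] V(1) W by simp
  moreover have "Phi = four_block_mat R Nm M L"
    unfolding R_def Nm_def M_def L_def
    by (rule four_block_sub_mat[symmetric]) (use Phi_eq Vc W in auto)
  ultimately have "?loop * four_block_mat R Nm M L = W"
    by (simp only:)
  note phi = feedback_block_equations[OF F B G K_dim R Nm M L this[unfolded W_def]]

  \<comment> \<open>Properness of the closed-loop blocks\<close>
  define H where "H = rmat A + rmat B2 * G"
  define V' where "V' = s_var \<cdot>\<^sub>m R"
  define Mh where "Mh = s_var \<cdot>\<^sub>m M"
  define P where "P = V' - 1\<^sub>m n"
  have H: "H \<in> carrier_mat n n"
    unfolding H_def by (intro add_carrier_mat BG)
  have V': "V' \<in> carrier_mat n n"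
    unfolding V'_def by (intro smult_carrier_mat R)
  have Mh: "Mh \<in> carrier_mat m n"
    unfolding Mh_def by (intro smult_carrier_mat M)
  have P: "P \<in> carrier_mat n n"
    unfolding P_def by (intro minus_carrier_mat one_carrier_mat)
  have V'_eq: "V' = 1\<^sub>m n + H * R"
  proof -
    have "F * R = ?s1 * R - rmat A * R"
      unfolding F_def by (rule minus_mult_distrib_mat) (use R plant in auto)
    also have "?s1 * R = V'"
      using R by (simp add: V'_def mult_smult_assoc_mat[of _ n n])
    finally have "V' - rmat A * R = 1\<^sub>m n + rmat B2 * G * R"
      using phi(1) by simp
    moreover have "H * R = rmat A * R + rmat B2 * G * R"
      unfolding H_def by (rule add_mult_distrib_mat) (use R plant BG in auto)
    moreover have "V' = (V' - rmat A * R) + rmat A * R"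
      using V' R plant by (intro eq_matI) auto
    ultimately show ?thesis
      using R plant BG by (auto intro!: eq_matI)
  qed
  \<comment> \<open>With \<open>R\<close> written as V'/s, the equation becomes a fixed-point
    equation for \<open>V'\<close> whose coefficient \<open>H\<close> is proper because
    \<open>K\<close> is.\<close>
  have HR: "H * R = inverse s_var \<cdot>\<^sub>m (H * V')"
    using H R by (intro eq_matI) (auto simp: V'_def mult_smult_distrib[of _ n n])
  have G_proper: "proper_tf G"
    unfolding G_def using K_dim plant K_proper by (intro proper_tf_mult[of _ m p _ n]) auto
  have H_proper: "proper_tf H"
    unfolding H_def using plant B G G_proper
    by (intro proper_tf_add[of _ n n] proper_tf_mult[of _ n m _ n]) auto
  have V'_proper: "proper_tf V'"
    using V'_eq HR by (intro proper_tf_fixed_point[OF V' H H_proper]) simp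
  \<comment> \<open>Since P = H R, the product s P is again H V', so \<open>P\<close> is strictly
    proper.\<close>
  have sP: "s_var \<cdot>\<^sub>m P = H * V'"
    unfolding P_def using V' H R by (subst V'_eq) (auto simp: HR intro!: eq_matI)
  have P_sproper: "proper_tf (s_var \<cdot>\<^sub>m P)"
    unfolding sP by (rule proper_tf_mult[OF H V' H_proper V'_proper])
  have "s_var \<cdot>\<^sub>m Nm = V' * (rmat B2 * K)"
    unfolding V'_def phi(3) using R BK by (simp add: mult_smult_assoc_mat[of _ n n])
  hence Nm_sproper: "proper_tf (s_var \<cdot>\<^sub>m Nm)"
    using proper_tf_mult[OF V' BK V'_proper proper_tf_mult[OF B K_dim proper_tf_rmat K_proper]]
    by simp
  have "Mh = G * V'"
    unfolding Mh_def V'_def phi(2) using G R by (simp add: mult_smult_distrib[of _ m n])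
  hence Mh_proper: "proper_tf Mh"
    using proper_tf_mult[OF G V' G_proper V'_proper] by simp
  have "proper_tf Nm"
    using Nm_sproper Nm by (auto simp: proper_tf_def intro: proper_rf_cancel_s_var)
  hence L_proper: "proper_tf L"
    unfolding phi(4) using G Nm K_dim G_proper K_proper
    by (auto intro!: proper_tf_add[of _ m p] proper_tf_mult[of _ m n _ p])

  \<comment> \<open>The controller as a feedback interconnection of closed-loop blocks\<close>
  define \<beta> where "\<beta> = inverse s_var \<cdot>\<^sub>m (rmat B2 * K)"
  have \<beta>: "\<beta> \<in> carrier_mat n p"
    using BK by (simp add: \<beta>_def)
  \<comment> \<open>As V' = I + P, the integrated control input \<beta> = B2 K / s solves the loop
    equation explicitly, without inverting I + P.\<close>
  have V'\<beta>: "V' * \<beta> = Nm"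
    unfolding V'_def \<beta>_def phi(3) using R BK
    by (auto simp: mult_smult_assoc_mat[of _ n n] mult_smult_distrib[of _ n n] intro!: eq_matI)
  have "V' * \<beta> = 1\<^sub>m n * \<beta> + P * \<beta>"
    using P V' by (subst add_mult_distrib_mat[symmetric, OF _ P \<beta>])
      (auto simp: P_def intro!: arg_cong[where f = "\<lambda>Q. Q * \<beta>"] eq_matI)
  hence fp: "\<beta> + P * \<beta> = Nm"
    using V'\<beta> \<beta> by simp
  \<comment> \<open>The factors s and 1/s cancel, leaving G R B2 K = G N, exactly the excess of
    \<open>L\<close> over \<open>K\<close>.\<close>
  have "Mh * \<beta> = M * (rmat B2 * K)"
    unfolding Mh_def \<beta>_def using M BK
    by (auto simp: mult_smult_assoc_mat[of _ m n] mult_smult_distrib[of _ m n] intro!: eq_matI)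
  also have "\<dots> = G * Nm"
    unfolding phi(2) phi(3) by (rule assoc_mult_mat[OF G R BK])
  finally have K_eq: "L - Mh * \<beta> = K"
    using phi(4) K_dim G Nm by (auto intro!: eq_matI)

  \<comment> \<open>The stacked transfer matrix and its structure\<close>
  define T where "T = four_block_mat P Nm Mh L"
  have T: "T \<in> carrier_mat (n + m) (n + p)"
    using P L by (auto simp: T_def)
  have T_index:
    "a < n \<Longrightarrow> b < n \<Longrightarrow> T $$ (a, b) = P $$ (a, b)"
    "a < n \<Longrightarrow> b < p \<Longrightarrow> T $$ (a, n + b) = Nm $$ (a, b)"
    "a' < m \<Longrightarrow> b < n \<Longrightarrow> T $$ (n + a', b) = Mh $$ (a', b)"
    "a' < m \<Longrightarrow> b < p \<Longrightarrow> T $$ (n + a', n + b) = L $$ (a', b)" for a a' b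
    using P Nm Mh L by (auto simp: T_def)
  \<comment> \<open>Strict properness of the first \<open>n\<close> rows will remove the feedthrough
    into \<beta>.\<close>
  have T_sproper: "proper_rf (s_var * T $$ (a, b))" if "a < n" "b < n + p" for a b
  proof (cases "b < n")
    case True
    thus ?thesis
      using P_sproper P that by (auto simp: proper_tf_def T_index)
  next
    case False
    thus ?thesis
      using Nm_sproper Nm that T_index(2)[of a "b - n"] by (auto simp: proper_tf_def)
  qed
  have T_proper: "proper_rf (T $$ (a, b))" if "a < n + m" "b < n + p" for a b
  proof (cases "a < n")
    case True
    thus ?thesis
      using T_sproper that proper_rf_cancel_s_var by blast
  next
    case False
    thus ?thesis
      using Mh_proper L_proper Mh L P that by (auto simp: proper_tf_def T_def)
  qed

  define row where "row a = (if a < n then sx a else su (a - n))" for a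
  define col where "col b = (if b < n then sx b else sy (b - n))" for b
  have row_less: "row a < N" if "a < n + m" for a
    using that sites by (auto simp: row_def site_map_def)
  have Adj_row: "Adj $$ (row a, row a) \<noteq> 0" if "a < n + m" for a
    using row_less[OF that] Adj_diag by simp
  have R_S: "in_S Adj R sx sx" and N_S: "in_S Adj Nm sx sy"
    and M_S: "in_S Adj M su sx" and L_S: "in_S Adj L su sy"
    using cl unfolding cl_TF_structured_def Let_def dims R_def Nm_def M_def L_def Phi_def by auto
  have T_S: "T $$ (a, b) = 0" if ab: "a < n + m" "b < n + p" and 0: "Adj $$ (row a, col b) = 0" for a b
  proof -
    \<comment> \<open>Subtracting the identity from s R changes only diagonal entries, and there
      \<open>Adj\<close> is 1; off the diagonal \<open>P\<close> has the zeros of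
      \<open>R\<close>.\<close>
    have "a \<noteq> b" if "a < n" "b < n"
      using that 0 Adj_diag row_less[of a] by (auto simp: row_def col_def)
    thus ?thesis
      using R_S N_S M_S L_S R Nm M L P Mh ab 0
      by (auto simp: in_S_def row_def col_def T_def P_def V'_def Mh_def split: if_splits)
  qed

  \<comment> \<open>Joint realization of the stacked system\<close>
  obtain k :: nat and \<rho> :: "nat \<Rightarrow> nat" and a b c d :: "nat \<Rightarrow> nat \<Rightarrow> real"
    and X :: "nat \<Rightarrow> nat \<Rightarrow> rfun" where
    \<rho>: "\<And>i. i < k \<Longrightarrow> \<rho> i < n + m" and
    a: "\<And>i j. i < k \<Longrightarrow> j < k \<Longrightarrow> a i j \<noteq> 0 \<Longrightarrow> \<rho> i = \<rho> j" and
    b: "\<And>i j. i < k \<Longrightarrow> j < n + p \<Longrightarrow> b i j \<noteq> 0 \<Longrightarrow> T $$ (\<rho> i, j) \<noteq> 0" and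
    c: "\<And>i j. i < n + m \<Longrightarrow> j < k \<Longrightarrow> c i j \<noteq> 0 \<Longrightarrow> \<rho> j = i" and
    d: "\<And>i j. i < n + m \<Longrightarrow> j < n + p \<Longrightarrow> d i j \<noteq> 0 \<Longrightarrow> \<not> proper_rf (s_var * T $$ (i, j))" and
    X: "\<And>i j. i < k \<Longrightarrow> j < n + p \<Longrightarrow>
       s_var * X i j = (\<Sum>l<k. const_rf (a i l) * X l j) + const_rf (b i j)" and
    TX: "\<And>i j. i < n + m \<Longrightarrow> j < n + p \<Longrightarrow>
       T $$ (i, j) = (\<Sum>l<k. const_rf (c i l) * X l j) + const_rf (d i j)"
  proof (rule row_located_realization[of "n + m" "n + p" "\<lambda>a b. T $$ (a, b)", OF T_proper], goal_cases)
    case (3 k \<rho> a b c d X)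
    show ?thesis
      by (rule that[where k = k and \<rho> = \<rho> and a = a and b = b and c = c and d = d and X = X])
        (fact 3)+
  qed
  have d0: "d i j = 0" if "i < n" "j < n + p" for i j
    using d[of i j] T_sproper[OF that] that by auto
  \<comment> \<open>A zero entry would be strictly proper and so have no feedthrough.\<close>
  have dT: "T $$ (i, j) \<noteq> 0" if "i < n + m" "j < n + p" "d i j \<noteq> 0" for i j
    using d[OF that] by auto

  \<comment> \<open>The realization is cut along the stacking: an offset \<open>n\<close> selects
    the inputs y among columns and the outputs u among rows.\<close>
  define A' where "A' = mat k k (\<lambda>(i, j). a i j)"
  define B1' where "B1' = mat k n (\<lambda>(i, j). b i j)"
  define By' where "By' = mat k p (\<lambda>(i, j). b i (n + j))"
  define C1' where "C1' = mat n k (\<lambda>(i, j). c i j)"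
  define Cu' where "Cu' = mat m k (\<lambda>(i, j). c (n + i) j)"
  define Du1' where "Du1' = mat m n (\<lambda>(i, j). d (n + i) j)"
  define Duy' where "Duy' = mat m p (\<lambda>(i, j). d (n + i) (n + j))"
  define X1 where "X1 = mat k n (\<lambda>(i, j). X i j)"
  define Xy where "Xy = mat k p (\<lambda>(i, j). X i (n + j))"
  note mat_defs = A'_def B1'_def By'_def C1'_def Cu'_def Du1'_def Duy'_def X1_def Xy_def
  have A': "A' \<in> carrier_mat k k" and B1': "B1' \<in> carrier_mat k n" and By': "By' \<in> carrier_mat k p"
    and C1': "C1' \<in> carrier_mat n k" and Cu': "Cu' \<in> carrier_mat m k"
    and Du1': "Du1' \<in> carrier_mat m n" and Duy': "Duy' \<in> carrier_mat m p"
    and X1: "X1 \<in> carrier_mat k n" and Xy: "Xy \<in> carrier_mat k p"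
    by (simp_all add: mat_defs)
  let ?F = "s_var \<cdot>\<^sub>m 1\<^sub>m k - rmat A'"
  have F': "?F \<in> carrier_mat k k"
    using A' by simp
  have FX1: "?F * X1 = rmat B1'" and FXy: "?F * Xy = rmat By'"
    unfolding mat_defs by (rule state_equation_mat, rule X; simp)+
  have "P = rmat C1' * X1 + rmat (mat n n (\<lambda>(i, j). d i j))"
    unfolding mat_defs by (rule output_equation_mat[OF P]) (simp add: TX flip: T_index)
  also have "mat n n (\<lambda>(i, j). d i j) = 0\<^sub>m n n"
    by (intro eq_matI) (auto simp: d0)
  also have "rmat C1' * X1 + rmat (0\<^sub>m n n) = rmat C1' * X1"
    using C1' X1 by (intro eq_matI) auto
  finally have P_eq: "P = rmat C1' * X1" .
  have "Nm = rmat C1' * Xy + rmat (mat n p (\<lambda>(i, j). d i (n + j)))"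
    unfolding mat_defs by (rule output_equation_mat[OF Nm]) (simp add: TX flip: T_index)
  also have "mat n p (\<lambda>(i, j). d i (n + j)) = 0\<^sub>m n p"
    by (intro eq_matI) (auto simp: d0)
  also have "rmat C1' * Xy + rmat (0\<^sub>m n p) = rmat C1' * Xy"
    using C1' Xy by (intro eq_matI) auto
  finally have Nm_eq: "Nm = rmat C1' * Xy" .
  have Mh_eq: "Mh = rmat Cu' * X1 + rmat Du1'"
    unfolding mat_defs by (rule output_equation_mat[OF Mh]) (simp add: TX flip: T_index)
  have L_eq: "L = rmat Cu' * Xy + rmat Duy'"
    unfolding mat_defs by (rule output_equation_mat[OF L]) (simp add: TX flip: T_index)

  \<comment> \<open>Closing the loop around the realization\<close>
  define AK where "AK = A' - B1' * C1'"
  define CK where "CK = Cu' - Du1' * C1'"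
  have AK: "AK \<in> carrier_mat k k" and CK: "CK \<in> carrier_mat m k"
    using B1' C1' Du1' by (auto simp: AK_def CK_def)
  define Z where "Z = Xy - X1 * \<beta>"
  have Z: "Z \<in> carrier_mat k p"
    using Xy X1 \<beta> by (auto simp: Z_def)
  \<comment> \<open>The feedback enters sI - AK with a plus sign, the form in which
    \<open>feedback_realization\<close> states the closed-loop equation.\<close>
  have AK_F: "s_var \<cdot>\<^sub>m 1\<^sub>m k - rmat AK = ?F + rmat B1' * rmat C1'"
    unfolding AK_def using A' B1' C1'
    by (subst rmat_minus[of _ k k]) (auto simp: rmat_mult[OF B1' C1'] intro!: eq_matI)
  have CK_eq: "rmat CK = rmat Cu' - rmat Du1' * rmat C1'"
    unfolding CK_def using Cu' Du1' C1'
    by (subst rmat_minus[of _ m k]) (auto simp: rmat_mult[OF Du1' C1'])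
  have fp': "\<beta> + rmat C1' * X1 * \<beta> = rmat C1' * Xy"
    using fp unfolding P_eq Nm_eq .
  have carr: "rmat B1' \<in> carrier_mat k n" "rmat By' \<in> carrier_mat k p" "rmat C1' \<in> carrier_mat n k"
    "rmat Cu' \<in> carrier_mat m k" "rmat Du1' \<in> carrier_mat m n" "rmat Duy' \<in> carrier_mat m p"
    using B1' By' C1' Cu' Du1' Duy' by simp_all
  note real = feedback_realization[OF F' carr X1 Xy \<beta> FX1 FXy fp', folded Z_def]
  have res: "resolvent AK \<in> carrier_mat k k" "resolvent AK * rmat By' = Z"
    using real(1) by (intro resolvent_mult_eqI[OF AK Z]; simp add: AK_F)+
  have "rmat CK * resolvent AK * rmat By' = rmat CK * Z"
    using assoc_mult_mat[of "rmat CK" m k "resolvent AK" k "rmat By'" p] CK res By' by simp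
  hence K_real: "K = rmat CK * resolvent AK * rmat By' + rmat Duy'"
    using real(2) K_eq by (simp add: CK_eq Mh_eq L_eq)

  \<comment> \<open>Sparsity of the closed-loop realization\<close>
  define sK where "sK i = row (\<rho> i)" for i
  have sK: "site_map N k sK"
    using row_less \<rho> by (auto simp: sK_def site_map_def)
  \<comment> \<open>This is site-diagonality of \<open>C1'\<close>: component \<open>i\<close> of
    \<beta> reads only states placed at its own site.\<close>
  have c_sx: "sK j = sx i" if "i < n" "j < k" "c i j \<noteq> 0" for i j
    using c[of i j] that by (auto simp: sK_def row_def)
  have AK_S: "in_S Adj AK sK sK"
    unfolding in_S_def
  proof (intro allI impI)
    fix i j assume "i < dim_row AK" "j < dim_col AK" and 0: "Adj $$ (sK i, sK j) = 0"
    hence ij: "i < k" "j < k"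
      using AK by auto
    \<comment> \<open>A nonzero entry would put both states in the same row, hence at one site,
      where the diagonal of \<open>Adj\<close> is 1.\<close>
    have "a i j = 0"
      using a[OF ij] 0 Adj_row[OF \<rho>[OF ij(1)]] by (metis sK_def)
    \<comment> \<open>The read-out step j to l stays at one site, so the product makes only the
      single hop of \<open>b i l\<close>, which the structure of \<open>T\<close> forbids
      here.\<close>
    moreover have "b i l * c l j = 0" if l: "l < n" for l
    proof (rule ccontr)
      assume nz: "b i l * c l j \<noteq> 0"
      hence "Adj $$ (sK i, sx l) = 0"
        using c_sx[of l j] l ij 0 by auto
      thus False
        using T_S[OF \<rho>, of i l] b[of i l] nz l ij by (auto simp: sK_def col_def)
    qed
    ultimately show "AK $$ (i, j) = 0"
      using ij by (auto simp: AK_def mat_defs scalar_prod_def intro!: sum.neutral)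
  qed
  have BK_S: "in_S Adj By' sK sy"
    unfolding in_S_def
  proof (intro allI impI)
    fix i j assume "i < dim_row By'" "j < dim_col By'" and 0: "Adj $$ (sK i, sy j) = 0"
    hence ij: "i < k" "j < p"
      using By' by auto
    have "T $$ (\<rho> i, n + j) = 0"
      using T_S[OF \<rho>, of i "n + j"] ij 0 by (simp add: sK_def col_def)
    thus "By' $$ (i, j) = 0"
      using b[of i "n + j"] ij by (auto simp: mat_defs)
  qed
  have CK_S: "in_S Adj CK su sK"
    unfolding in_S_def
  proof (intro allI impI)
    fix i j assume "i < dim_row CK" "j < dim_col CK" and 0: "Adj $$ (su i, sK j) = 0"
    hence ij: "i < m" "j < k"
      using CK by auto
    have "c (n + i) j = 0"
    proof (rule ccontr)
      assume "c (n + i) j \<noteq> 0"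
      hence "sK j = row (n + i)" "row (n + i) = su i"
        using c[of "n + i" j] ij by (auto simp: sK_def row_def)
      thus False
        using 0 Adj_row[of "n + i"] ij by simp
    qed
    \<comment> \<open>Again a site-diagonal read-out followed by one structured hop, now through the
      feedthrough of \<open>Mh\<close>.\<close>
    moreover have "d (n + i) l * c l j = 0" if l: "l < n" for l
    proof (rule ccontr)
      assume nz: "d (n + i) l * c l j \<noteq> 0"
      hence "Adj $$ (su i, sx l) = 0"
        using c_sx[of l j] l ij 0 by auto
      thus False
        using T_S[of "n + i" l] dT[of "n + i" l] nz l ij by (auto simp: row_def col_def)
    qed
    ultimately show "CK $$ (i, j) = 0"
      using ij by (auto simp: CK_def mat_defs scalar_prod_def intro!: sum.neutral)
  qed
  have DK_S: "in_S Adj Duy' su sy"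
    unfolding in_S_def
  proof (intro allI impI)
    fix i j assume "i < dim_row Duy'" "j < dim_col Duy'" and 0: "Adj $$ (su i, sy j) = 0"
    hence ij: "i < m" "j < p"
      using Duy' by auto
    have "T $$ (n + i, n + j) = 0"
      using T_S[of "n + i" "n + j"] ij 0 by (simp add: row_def col_def)
    thus "Duy' $$ (i, j) = 0"
      using dT[of "n + i" "n + j"] ij by (auto simp: mat_defs)
  qed
  show ?thesis
    unfolding structured_realizable_def
    using K_dim sK AK By' CK Duy' AK_S BK_S CK_S DK_S K_real
    by (intro exI[of _ k] exI[of _ sK] exI[of _ AK] exI[of _ By'] exI[of _ CK] exI[of _ Duy']) simp
qed

end
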